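(* Let $P\subseteq\mathbb{R}^n$ be a polytope, $D$ an upper bound on its Euclidean diameter, and $\mu\ge1$ a constant with the decomposition property described in the context. Let $f$ be convex, differentiable on a domain containing $P$, $\beta$-smooth and $S$-strongly convex with respect to the Euclidean norm, let $x^*$ be a minimum point of $f$ over $P$, $K\ge1$, $x_1\in P$ and $\Phi_0\ge f(x_1)-f(x^* )$, $\Phi_0>0$. Then the Lazy Local Conditional Gradient algorithm (described in the context), with $\alpha=\frac{S}{2K\beta n\mu^2}$, satisfies for all $t\ge0$ for which the quantities are defined $$f(x_{t+1})-f(x^* )\le\Phi_t\le\Phi_0\Big(\frac{1+\alpha/(2K)}{1+\alpha/K}\Big)^t.$$
   Context: $\|\cdot\|$ is the Euclidean norm. $f$ is $\beta$-smooth if $f(y)-f(x)\le\nabla f(x)(y-x)+\beta\|y-x\|^2/2$ for all $x,y$; $S$-strongly convex if $f(y)-f(x)\ge\nabla f(x)(y-x)+\frac S2\|y-x\|^2$ for all $x,y$. Decomposition property of $\mu$: for all $x,y\in P$ and every convex combination $x=\sum_i\lambda_iv_i$ of the vertices $v_i$ of $P$, there are $0\le\gamma_i\le\lambda_i$ and $z\in P$ with $x-y=\sum_i\gamma_i(v_i-z)$ and $\sum_i\gamma_i\le\frac{\sqrt n\mu}{D}\|x-y\|$. Weak separation oracle $\mathrm{LPsep}_P(c,x,\Phi,K)$: given $c$, $x\in P$, $\Phi>0$, $K\ge1$, returns either a vertex $y$ of $P$ with $c(x-y)>\Phi/K$, or false, which it may return only if $c(x-z)\le\Phi$ for all $z\in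 P$. Weak local separation $\mathrm{LLPsep}_P(c,x,r,\Phi,K)$: set $\Delta=\min\{\frac{\sqrt n\mu}{D}r,1\}$; write $x=\sum_{j=1}^M\lambda_jv_j$ with vertices $v_j$, $\lambda_j>0$, $\sum\lambda_j=1$; order so that $cv_{i_1}\ge\dots\ge cv_{i_M}$; let $k=\min\{k:\sum_{j\le k}\lambda_{i_j}\ge\Delta\}$ and $p_-=\sum_{j<k}\lambda_{i_j}v_{i_j}+(\Delta-\sum_{j<k}\lambda_{i_j})v_{i_k}$; let $v^*=\mathrm{LPsep}_P(c,p_-/\Delta,\Phi/\Delta,K)$; return false if $v^*$ is false, else return $x-p_-+\Delta v^*$. Lazy Local Conditional Gradient algorithm: for $t=1,\dots,T$: $r_t=\sqrt{2\Phi_{t-1}/S}$; $\Phi_t=\dfrac{\Phi_{t-1}+\frac\beta2\alpha^2\min\{n\mu^2r_t^2,D^2\}}{1+\alpha/K}$; $p_t=\mathrm{LLPsep}_P(\nabla f(x_t),x_t,r_t,\Phi_t,K)$; if $p_t$ is false put $x_{t+1}=x_t$, otherwise $x_{t+1}=x_t+\alpha(p_t-x_t)$. *)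

theory Defs
  imports "HOL-Analysis.Analysis"
begin

definition gradient :: "('a::real_inner \<Rightarrow> real) \<Rightarrow> 'a \<Rightarrow> 'a"
  where "gradient f x = (THE d. GDERIV f x :> d)"

lemma GDERIV_gradient:
  fixes f :: "'a::euclidean_space \<Rightarrow> real"
  assumes "f differentiable (at x)"
  shows "GDERIV f x :> gradient f x"
proof -
  obtain f' where f': "(f has_derivative f') (at x)"
    using assms unfolding differentiable_def by blast
  interpret linear f' using f' by (rule has_derivative_linear)
  define d where "d = (\<Sum>b\<in>Basis. f' b *\<^sub>R b)"
  have "f' h = inner h d" for h
  proof -
    have "f' h = f' (\<Sum>b\<in>Basis. (h \<bullet> b) *\<^sub>R b)" by (simp add: euclidean_representation)
    also have "\<dots> = (\<Sum>b\<in>Basis. (h \<bullet> b) * f' b)" by (simp add: sum scaleR)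
    also have "\<dots> = inner h d" by (simp add: d_def inner_sum_right mult.commute)
    finally show ?thesis .
  qed
  hence "f' = (\<lambda>h. inner h d)" by blast
  hence d: "GDERIV f x :> d" using f' by (simp add: gderiv_def)
  have "e = d" if "GDERIV f x :> e" for e
  proof -
    have "(\<lambda>h. inner h e) = (\<lambda>h. inner h d)"
      using that d unfolding gderiv_def by (rule has_derivative_unique)
    hence "inner (e - d) e = inner (e - d) d" by meson
    hence "inner (e - d) (e - d) = 0" by (simp add: inner_diff_right)
    thus ?thesis by simp
  qed
  with d show ?thesis unfolding gradient_def by (rule theI)
qed

definition smooth_function_on :: "'a::real_inner set \<Rightarrow> ('a \<Rightarrow> real) \<Rightarrow> real \<Rightarrow> bool"
  where "smooth_function_on U f \<beta> \<longleftrightarrow>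
    (\<forall>x\<in>U. \<forall>y\<in>U. f y - f x \<le> gradient f x \<bullet> (y - x) + \<beta> * (norm (y - x))\<^sup>2 / 2)"

definition strongly_convex_on :: "'a::real_inner set \<Rightarrow> ('a \<Rightarrow> real) \<Rightarrow> real \<Rightarrow> bool"
  where "strongly_convex_on U f S \<longleftrightarrow>
    (\<forall>x\<in>U. \<forall>y\<in>U. f y - f x \<ge> gradient f x \<bullet> (y - x) + S / 2 * (norm (y - x))\<^sup>2)"

definition vertices :: "'a::real_vector set \<Rightarrow> 'a set"
  where "vertices P = {v. v extreme_point_of P}"

definition decomposition_property :: "(real ^ 'n) set \<Rightarrow> real \<Rightarrow> real \<Rightarrow> bool"
  where "decomposition_property P D \<mu> \<longleftrightarrow>
    (\<forall>x\<in>P. \<forall>y\<in>P. \<forall>lam.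
      (\<forall>v\<in>vertices P. 0 \<le> lam v) \<and> (\<Sum>v\<in>vertices P. lam v) = 1 \<and>
      x = (\<Sum>v\<in>vertices P. lam v *\<^sub>R v) \<longrightarrow>
      (\<exists>\<gamma>. \<exists>z\<in>P. (\<forall>v\<in>vertices P. 0 \<le> \<gamma> v \<and> \<gamma> v \<le> lam v) \<and>
        x - y = (\<Sum>v\<in>vertices P. \<gamma> v *\<^sub>R (v - z)) \<and>
        (\<Sum>v\<in>vertices P. \<gamma> v) \<le> sqrt (real CARD('n)) * \<mu> / D * norm (x - y)))"

text \<open>
  The oracles are modelled as input/answer relations, with \<open>None\<close> for the answer ``false'', so that
  distinct calls with equal arguments may be answered differently. A weak separation oracle is
  unconstrained on inputs outside its specification.
\<close>

definition LPsep :: "'a::real_inner set \<Rightarrow> 'a \<Rightarrow> 'a \<Rightarrow> real \<Rightarrow> real \<Rightarrow> 'a option \<Rightarrow> bool"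
  where "LPsep P c x \<Phi> K ans \<longleftrightarrow>
    (x \<in> P \<and> \<Phi> > 0 \<and> K \<ge> 1 \<longrightarrow>
      (case ans of
         None \<Rightarrow> \<forall>z\<in>P. c \<bullet> (x - z) \<le> \<Phi>
       | Some y \<Rightarrow> y \<in> vertices P \<and> c \<bullet> (x - y) > \<Phi> / K))"

text \<open>
  The decomposition of \<open>x\<close>, the ordering \<open>i\<close> of its terms and the oracle answer \<open>vs\<close> are arbitrary
  admissible choices; the vertices \<open>v j\<close> need not be distinct.
\<close>

definition LLPsep ::
  "(real ^ 'n) set \<Rightarrow> real \<Rightarrow> real \<Rightarrow> real ^ 'n \<Rightarrow> real ^ 'n \<Rightarrow> real \<Rightarrow> real \<Rightarrow> real \<Rightarrow>
    (real ^ 'n) option \<Rightarrow> bool"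
  where "LLPsep P D \<mu> c x r \<Phi> K ans \<longleftrightarrow>
    (\<exists>(M::nat) lam v i k \<Delta> p vs.
      \<Delta> = min (sqrt (real CARD('n)) * \<mu> / D * r) 1 \<and>
      (\<forall>j\<in>{1..M}. v j \<in> vertices P \<and> lam j > 0) \<and>
      (\<Sum>j=1..M. lam j) = 1 \<and> x = (\<Sum>j=1..M. lam j *\<^sub>R v j) \<and>
      bij_betw i {1..M} {1..M} \<and>
      (\<forall>j\<in>{1..M}. \<forall>l\<in>{1..M}. j \<le> l \<longrightarrow> c \<bullet> v (i j) \<ge> c \<bullet> v (i l)) \<and>
      k = (LEAST k. (\<Sum>j=1..k. lam (i j)) \<ge> \<Delta>) \<and>
      p = (\<Sum>j=1..<k. lam (i j) *\<^sub>R v (i j)) + (\<Delta> - (\<Sum>j=1..<k. lam (i j))) *\<^sub>R v (i k) \<and>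
      LPsep P c (p /\<^sub>R \<Delta>) (\<Phi> / \<Delta>) K vs \<and>
      ans = (case vs of None \<Rightarrow> None | Some w \<Rightarrow> Some (x - p + \<Delta> *\<^sub>R w)))"

text \<open>
  \<open>x\<close> and \<open>\<Phi>\<close> record a run with \<open>T\<close> iterations: the relevant values are
  \<open>x 1, \<dots>, x (T + 1)\<close> and \<open>\<Phi> 0, \<dots>, \<Phi> T\<close>.
\<close>

definition lazy_local_CG_run ::
  "(real ^ 'n) set \<Rightarrow> real \<Rightarrow> real \<Rightarrow> (real ^ 'n \<Rightarrow> real) \<Rightarrow> real \<Rightarrow> real \<Rightarrow> real \<Rightarrow> real \<Rightarrow> nat \<Rightarrow>
    (nat \<Rightarrow> real ^ 'n) \<Rightarrow> (nat \<Rightarrow> real) \<Rightarrow> bool"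
  where "lazy_local_CG_run P D \<mu> f \<beta> S K \<alpha> T x \<Phi> \<longleftrightarrow>
    (\<forall>t\<in>{1..T}. \<exists>r p.
      r = sqrt (2 * \<Phi> (t - 1) / S) \<and>
      \<Phi> t = (\<Phi> (t - 1) + \<beta> / 2 * \<alpha>\<^sup>2 * min (real CARD('n) * \<mu>\<^sup>2 * r\<^sup>2) (D\<^sup>2)) / (1 + \<alpha> / K) \<and>
      LLPsep P D \<mu> (gradient f (x t)) (x t) r (\<Phi> t) K p \<and>
      x (t + 1) = (case p of None \<Rightarrow> x t | Some q \<Rightarrow> x t + \<alpha> *\<^sub>R (q - x t)))"

end

theory Submission imports Defs begin

text \<open>
  The oracle call of an iteration has one of two outcomes. A negative answer certifies
  \<open>c \<bullet> (x - y) \<le> \<Phi>\<close> for every \<open>y\<close> in \<open>P\<close> within distance \<open>r\<close> of \<open>x\<close>: by the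
  decomposition property \<open>x - y\<close> moves mass at most \<open>\<Delta>\<close>, and no such move gains more than
  moving the \<open>\<Delta>\<close>-part of \<open>x\<close> on which \<open>c\<close> is largest. Strong convexity places the
  minimiser in that ball. A positive answer gives a point at distance at most
  \<open>\<Delta> * D\<close> with gain greater than \<open>\<Phi> / K\<close>, and smoothness turns this into descent;
  the recursion for \<open>\<Phi>\<close> makes the resulting bound exactly the next value of \<open>\<Phi>\<close>.
\<close>

section \<open>Greedy selection of mass from a sorted decomposition\<close>

text \<open>The point \<open>p\<close> of the local separation is defined by a prefix sum and a
  fractional last term. Spreading it over all indices as weights \<open>m\<close>, zero beyond
  \<open>k\<close>, lets it be compared termwise with \<open>l\<close> and subtracted from
  it.\<close>

lemma greedy_weights:
  fixes l :: "nat \<Rightarrow> real" and u :: "nat \<Rightarrow> 'a::real_vector"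
  assumes nonneg: "\<And>j. j \<in> {1..M} \<Longrightarrow> 0 \<le> l j"
    and total: "\<Delta> \<le> (\<Sum>j=1..M. l j)" and pos: "0 < \<Delta>"
    and k: "k = (LEAST k. (\<Sum>j=1..k. l j) \<ge> \<Delta>)"
  obtains m where "k \<in> {1..M}" "\<And>j. j \<in> {1..M} \<Longrightarrow> 0 \<le> m j \<and> m j \<le> l j"
    "(\<Sum>j=1..M. m j) = \<Delta>" "\<And>j. j < k \<Longrightarrow> m j = l j" "\<And>j. k < j \<Longrightarrow> m j = 0"
    "(\<Sum>j=1..M. m j *\<^sub>R u j) = (\<Sum>j=1..<k. l j *\<^sub>R u j) + (\<Delta> - (\<Sum>j=1..<k. l j)) *\<^sub>R u k"
proof -
  have ge: "(\<Sum>j=1..k. l j) \<ge> \<Delta>"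
    unfolding k by (rule LeastI[of _ M]) (rule total)
  have kM: "k \<le> M"
    unfolding k by (rule Least_le) (rule total)
  \<comment> \<open>At 0 the sum is empty, hence below \<Delta>. So \<open>k - 1\<close> is a
    genuine predecessor, at which the minimality of \<open>k\<close> can be used.\<close>
  have k1: "1 \<le> k"
    using ge pos by (cases k) auto
  have "\<not> (\<Sum>j=1..k-1. l j) \<ge> \<Delta>"
    using k1 unfolding k by (intro not_less_Least) linarith
  moreover have "{1..k-1} = {1..<k}"
    using k1 by auto
  ultimately have lt: "(\<Sum>j=1..<k. l j) < \<Delta>"
    by simp
  have upto_k: "{1..k} = insert k {1..<k}"
    using k1 by auto
  have le: "\<Delta> - (\<Sum>j=1..<k. l j) \<le> l k"
    using ge unfolding upto_k by simp
  define m where "m = (\<lambda>j. if j < k then l j else if j = k then \<Delta> - (\<Sum>j=1..<k. l j) else 0)"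
  \<comment> \<open>The vector type is left generic: the constant real family 1 gives the total mass
    of \<open>m\<close>, the family \<open>u\<close> gives the point itself.\<close>
  have split: "(\<Sum>j=1..M. m j *\<^sub>R w j) =
      (\<Sum>j=1..<k. l j *\<^sub>R w j) + (\<Delta> - (\<Sum>j=1..<k. l j)) *\<^sub>R w k" for w :: "nat \<Rightarrow> 'b::real_vector"
  proof -
    have "(\<Sum>j=1..M. m j *\<^sub>R w j) = (\<Sum>j=1..k. m j *\<^sub>R w j)"
      using kM by (intro sum.mono_neutral_right) (auto simp: m_def)
    also have "\<dots> = (\<Sum>j=1..<k. m j *\<^sub>R w j) + m k *\<^sub>R w k"
      unfolding upto_k by simp
    also have "(\<Sum>j=1..<k. m j *\<^sub>R w j) = (\<Sum>j=1..<k. l j *\<^sub>R w j)"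
      by (intro sum.cong) (auto simp: m_def)
    finally show ?thesis
      by (simp add: m_def)
  qed
  show thesis
  proof
    show "(\<Sum>j=1..M. m j) = \<Delta>"
      using split[of "\<lambda>_. 1::real"] by simp
    show "0 \<le> m j \<and> m j \<le> l j" if "j \<in> {1..M}" for j
      using nonneg[OF that] lt le by (auto simp: m_def)
  qed (use k1 kM split in \<open>auto simp: m_def\<close>)
qed

lemma convex_combination_mem:
  fixes u :: "nat \<Rightarrow> 'a::real_vector"
  assumes "convex P" and "\<And>j. j \<in> {1..M} \<Longrightarrow> u j \<in> P" and "\<And>j. j \<in> {1..M} \<Longrightarrow> 0 \<le> m j"
    and "(\<Sum>j=1..M. m j) = 1"
  shows "(\<Sum>j=1..M. m j *\<^sub>R u j) \<in> P"
  using assms by (intro convex_sum) auto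

text \<open>Complementary slackness for a fractional knapsack with price \<open>b k\<close>: before
  \<open>k\<close> the excess is nonnegative and the full weight is taken, at \<open>k\<close> it
  vanishes, and after \<open>k\<close> it is not positive and no weight is taken. The fractional
  weight at \<open>k\<close> therefore does not matter.\<close>

lemma greedy_threshold:
  fixes l m b :: "nat \<Rightarrow> real"
  assumes "k \<in> {1..M}"
    and "\<And>j. j < k \<Longrightarrow> m j = l j" and "\<And>j. k < j \<Longrightarrow> m j = 0"
    and "\<And>i j. i \<in> {1..M} \<Longrightarrow> j \<in> {1..M} \<Longrightarrow> i \<le> j \<Longrightarrow> b j \<le> b i"
  shows "(\<Sum>j=1..M. l j * max 0 (b j - b k)) = (\<Sum>j=1..M. m j * (b j - b k))"
proof (rule sum.cong)
  fix j assume j: "j \<in> {1..M}"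
  consider "j < k" | "j = k" | "k < j" by linarith
  then show "l j * max 0 (b j - b k) = m j * (b j - b k)"
  proof cases
    case 1
    then have "b k \<le> b j" using assms(1,4) j by simp
    with 1 show ?thesis by (simp add: assms(2))
  next
    case 3
    then have "b j \<le> b k" using assms(1,4) j by simp
    with 3 show ?thesis by (simp add: assms(3))
  qed simp
qed simp

section \<open>Correctness of the weak local separation\<close>

text \<open>A negative answer is handled by weak duality for the problem of moving mass at most
  \<Delta> out of \<open>x\<close>, with the threshold vertex \<open>u k\<close> supplying the dual
  price. For a positive answer, mass \<Delta> is moved from \<open>p\<close> to the vertex found, so
  \<open>q - x\<close> is \<Delta> times a difference of two points of \<open>P\<close>.\<close>

lemma LLPsep_sound:
  fixes P :: "(real ^ 'n) set"
  assumes P: "polytope P" and D: "D > 0" "diameter P \<le> D" and \<mu>: "\<mu> > 0"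
    and decomp: "decomposition_property P D \<mu>"
    and r: "r > 0" and \<Phi>: "\<Phi> > 0" and K: "K \<ge> 1"
    and sep: "LLPsep P D \<mu> c x r \<Phi> K ans"
  shows "case ans of
      None \<Rightarrow> \<forall>y\<in>P. norm (x - y) \<le> r \<longrightarrow> c \<bullet> (x - y) \<le> \<Phi>
    | Some q \<Rightarrow> q \<in> P \<and> c \<bullet> (x - q) > \<Phi> / K \<and>
        norm (q - x) \<le> min (sqrt (real CARD('n)) * \<mu> * r) D"
proof -
  define \<Delta> where "\<Delta> = min (sqrt (real CARD('n)) * \<mu> / D * r) 1"
  obtain M k :: nat and lam v i p vs where
      k: "k = (LEAST k. (\<Sum>j=1..k. lam (i j)) \<ge> \<Delta>)"
    and v: "\<And>j. j \<in> {1..M} \<Longrightarrow> v j \<in> vertices P \<and> lam j > 0"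
    and lam1: "(\<Sum>j=1..M. lam j) = 1" and x: "x = (\<Sum>j=1..M. lam j *\<^sub>R v j)"
    and i: "bij_betw i {1..M} {1..M}"
    and sorted: "\<And>j l. j \<in> {1..M} \<Longrightarrow> l \<in> {1..M} \<Longrightarrow> j \<le> l \<Longrightarrow> c \<bullet> v (i j) \<ge> c \<bullet> v (i l)"
    and p: "p = (\<Sum>j=1..<k. lam (i j) *\<^sub>R v (i j)) + (\<Delta> - (\<Sum>j=1..<k. lam (i j))) *\<^sub>R v (i k)"
    and LP: "LPsep P c (p /\<^sub>R \<Delta>) (\<Phi> / \<Delta>) K vs"
    and ans: "ans = (case vs of None \<Rightarrow> None | Some w \<Rightarrow> Some (x - p + \<Delta> *\<^sub>R w))"
    using sep unfolding LLPsep_def \<Delta>_def by blast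
  define l u where "l = (\<lambda>j. lam (i j))" and "u = (\<lambda>j. v (i j))"
  have iM: "i j \<in> {1..M}" if "j \<in> {1..M}" for j
    using i that by (auto simp: bij_betw_def)
  have u_vertex: "u j \<in> vertices P" and l_pos: "0 < l j" if "j \<in> {1..M}" for j
    using v[OF iM[OF that]] by (auto simp: u_def l_def)
  have l1: "(\<Sum>j=1..M. l j) = 1"
    using sum.reindex_bij_betw[OF i, of lam] lam1 by (simp add: l_def)
  have x_u: "x = (\<Sum>j=1..M. l j *\<^sub>R u j)"
    using sum.reindex_bij_betw[OF i, of "\<lambda>j. lam j *\<^sub>R v j"] x by (simp add: l_def u_def)
  have \<Delta>: "0 < \<Delta>" "\<Delta> \<le> 1"
    using D \<mu> r by (auto simp: \<Delta>_def)
  have vertices_P: "vertices P \<subseteq> P"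
    by (auto simp: vertices_def extreme_point_of_def)
  have u_P: "u j \<in> P" if "j \<in> {1..M}" for j
    using u_vertex[OF that] vertices_P by blast
  have convex: "convex P" and compact: "compact P"
    using P by (simp_all add: polytope_imp_convex polytope_imp_compact)
  have l_nonneg: "0 \<le> l j" if "j \<in> {1..M}" for j
    using l_pos[OF that] by simp
  have total: "\<Delta> \<le> (\<Sum>j=1..M. l j)"
    using l1 \<Delta> by simp
  have k_l: "k = (LEAST k. (\<Sum>j=1..k. l j) \<ge> \<Delta>)"
    using k by (simp only: l_def)
  obtain m where kM: "k \<in> {1..M}" and m: "\<And>j. j \<in> {1..M} \<Longrightarrow> 0 \<le> m j \<and> m j \<le> l j"
    and m_sum: "(\<Sum>j=1..M. m j) = \<Delta>"
    and m_below: "\<And>j. j < k \<Longrightarrow> m j = l j" and m_above: "\<And>j. k < j \<Longrightarrow> m j = 0"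
    and m_u: "(\<Sum>j=1..M. m j *\<^sub>R u j) =
      (\<Sum>j=1..<k. l j *\<^sub>R u j) + (\<Delta> - (\<Sum>j=1..<k. l j)) *\<^sub>R u k"
    using greedy_weights[OF l_nonneg total \<Delta>(1) k_l, where u = u] by blast
  have mp: "(\<Sum>j=1..M. m j *\<^sub>R u j) = p"
    using m_u p by (simp only: l_def u_def)
  \<comment> \<open>The oracle promises something only for query points in \<open>P\<close>; the
    weights \<open>m j / \<Delta>\<close> exhibit this one as a convex combination of
    vertices.\<close>
  have pP: "p /\<^sub>R \<Delta> \<in> P"
  proof -
    have "(\<Sum>j=1..M. (m j / \<Delta>) *\<^sub>R u j) \<in> P"
      using \<Delta> m m_sum u_P convex
      by (intro convex_combination_mem) (auto simp flip: sum_divide_distrib)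
    then show ?thesis
      by (simp add: scaleR_sum_right divide_inverse_commute flip: mp)
  qed
  have xP: "x \<in> P"
    unfolding x_u using l_pos l1 u_P convex
    by (intro convex_combination_mem) (auto simp: less_imp_le)
  have LP': "case vs of None \<Rightarrow> \<forall>z\<in>P. c \<bullet> (p /\<^sub>R \<Delta> - z) \<le> \<Phi> / \<Delta>
      | Some y \<Rightarrow> y \<in> vertices P \<and> c \<bullet> (p /\<^sub>R \<Delta> - y) > \<Phi> / \<Delta> / K"
    using LP pP \<Phi> \<Delta> K unfolding LPsep_def by simp
  have inner_p: "c \<bullet> (p - \<Delta> *\<^sub>R z) = \<Delta> * (c \<bullet> (p /\<^sub>R \<Delta> - z))" for z
    using \<Delta> by (simp add: algebra_simps)
  show ?thesis
  proof (cases vs)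
    case None
    have "c \<bullet> (x - y) \<le> \<Phi>" if y: "y \<in> P" "norm (x - y) \<le> r" for y
    proof -
      have fin: "finite (vertices P)"
        using P unfolding vertices_def
        by (simp add: finite_polyhedron_extreme_points polytope_imp_polyhedron)
      \<comment> \<open>The decomposition property takes weights indexed by the vertices themselves,
        while the \<open>u j\<close> may repeat. \<open>L\<close> adds up the weights of equal
        vertices, and \<open>group\<close> transfers sums between the two indexings.\<close>
      define L where "L = (\<lambda>w. \<Sum>j\<in>{j\<in>{1..M}. u j = w}. l j)"
      have group: "(\<Sum>w\<in>vertices P. L w *\<^sub>R g w) = (\<Sum>j=1..M. l j *\<^sub>R g (u j))"
        for g :: "real ^ 'n \<Rightarrow> 'b::real_vector"
      proof -
        have "L w *\<^sub>R g w = (\<Sum>j\<in>{j\<in>{1..M}. u j = w}. l j *\<^sub>R g (u j))" for w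
          unfolding L_def scaleR_sum_left by (intro sum.cong) auto
        moreover have "u ` {1..M} \<subseteq> vertices P"
          using u_vertex by blast
        ultimately show ?thesis
          using sum.group[of "{1..M}" "vertices P" u "\<lambda>j. l j *\<^sub>R g (u j)"] fin
          by (simp only: finite_atLeastAtMost)
      qed
      have "\<forall>w\<in>vertices P. 0 \<le> L w"
        using l_pos by (auto simp: L_def less_imp_le intro!: sum_nonneg)
      moreover have L1: "(\<Sum>w\<in>vertices P. L w) = 1"
        using group[of "\<lambda>_. 1::real"] l1 by simp
      moreover have "x = (\<Sum>w\<in>vertices P. L w *\<^sub>R w)"
        using group[of "\<lambda>w. w"] x_u by simp
      ultimately obtain \<gamma> z where z: "z \<in> P"
        and \<gamma>: "\<And>w. w \<in> vertices P \<Longrightarrow> 0 \<le> \<gamma> w \<and> \<gamma> w \<le> L w"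
        and diff: "x - y = (\<Sum>w\<in>vertices P. \<gamma> w *\<^sub>R (w - z))"
        and mass: "(\<Sum>w\<in>vertices P. \<gamma> w) \<le> sqrt (real CARD('n)) * \<mu> / D * norm (x - y)"
        using decomp[unfolded decomposition_property_def, rule_format, OF xP y(1), of L] by blast
      \<comment> \<open>The two arguments of the minimum in \<Delta> are treated separately: the
        total weight 1 bounds the moved mass, and so does the decomposition bound at distance
        \<open>r\<close>.\<close>
      have "(\<Sum>w\<in>vertices P. \<gamma> w) \<le> (\<Sum>w\<in>vertices P. L w)"
        using \<gamma> by (intro sum_mono) auto
      moreover have "sqrt (real CARD('n)) * \<mu> / D * norm (x - y) \<le> sqrt (real CARD('n)) * \<mu> / D * r"
        using y(2) \<mu> D by (intro mult_left_mono) auto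
      ultimately have mass_\<Delta>: "(\<Sum>w\<in>vertices P. \<gamma> w) \<le> \<Delta>"
        using mass L1 by (simp add: \<Delta>_def)
      obtain z0 where z0: "z0 \<in> P" "\<And>w. w \<in> P \<Longrightarrow> c \<bullet> z0 \<le> c \<bullet> w"
      proof -
        have "continuous_on P (\<lambda>w. c \<bullet> w)"
          by (intro continuous_intros)
        then show ?thesis
          using continuous_attains_inf[OF compact, of "\<lambda>w. c \<bullet> w"] xP that by blast
      qed
      \<comment> \<open>\<tau> is the dual price of a unit of moved mass: the gain from moving it
        from the threshold vertex to the cheapest point \<open>z0\<close>.\<close>
      define \<tau> where "\<tau> = c \<bullet> u k - c \<bullet> z0"
      have \<tau>: "0 \<le> \<tau>"
        using z0(2)[OF u_P[OF kM]] by (simp add: \<tau>_def)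
      have "c \<bullet> (x - y) = (\<Sum>w\<in>vertices P. \<gamma> w * (c \<bullet> w - c \<bullet> z))"
        by (simp add: diff inner_sum_right inner_diff_right)
      \<comment> \<open>Only the nonnegative excess over the threshold has its weight enlarged from
        \<gamma> to \<open>L\<close>. The \<tau> share keeps \<gamma>, whose total is at most
        \<Delta>.\<close>
      also have "\<dots> \<le> (\<Sum>w\<in>vertices P. L w * max 0 (c \<bullet> w - c \<bullet> u k) + \<gamma> w * \<tau>)"
      proof (rule sum_mono)
        fix w assume w: "w \<in> vertices P"
        have "\<gamma> w * (c \<bullet> w - c \<bullet> z) \<le> \<gamma> w * (max 0 (c \<bullet> w - c \<bullet> u k) + \<tau>)"
          using \<gamma>[OF w] z0(2)[OF z] by (intro mult_left_mono) (auto simp: \<tau>_def)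
        also have "\<dots> \<le> L w * max 0 (c \<bullet> w - c \<bullet> u k) + \<gamma> w * \<tau>"
          using \<gamma>[OF w] by (simp add: distrib_left mult_right_mono)
        finally show "\<gamma> w * (c \<bullet> w - c \<bullet> z) \<le> L w * max 0 (c \<bullet> w - c \<bullet> u k) + \<gamma> w * \<tau>" .
      qed
      also have "\<dots> = (\<Sum>j=1..M. l j * max 0 (c \<bullet> u j - c \<bullet> u k)) + (\<Sum>w\<in>vertices P. \<gamma> w) * \<tau>"
        using group[of "\<lambda>w. max 0 (c \<bullet> w - c \<bullet> u k)"] by (simp add: sum.distrib sum_distrib_right)
      also have "\<dots> \<le> (\<Sum>j=1..M. m j * (c \<bullet> u j - c \<bullet> u k)) + \<Delta> * \<tau>"
      proof -
        have "(\<Sum>j=1..M. l j * max 0 (c \<bullet> u j - c \<bullet> u k)) = (\<Sum>j=1..M. m j * (c \<bullet> u j - c \<bullet> u k))"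
          using kM m_below m_above sorted
          by (intro greedy_threshold[of k M m l "\<lambda>j. c \<bullet> u j"]) (auto simp: u_def)
        then show ?thesis
          using mass_\<Delta> \<tau> by (simp add: mult_right_mono)
      qed
      also have "\<dots> = c \<bullet> p - (\<Sum>j=1..M. m j) * (c \<bullet> u k) + \<Delta> * \<tau>"
        by (simp add: inner_sum_right sum_subtractf sum_distrib_right right_diff_distrib flip: mp)
      \<comment> \<open>The threshold terms cancel because \<open>m\<close> has total mass exactly
        \<Delta>; what remains is \<Delta> times the gap that the oracle certified.\<close>
      also have "\<dots> = c \<bullet> (p - \<Delta> *\<^sub>R z0)"
        unfolding m_sum by (simp add: \<tau>_def algebra_simps)
      also have "\<dots> \<le> \<Phi>"
        using LP' None z0(1) \<Delta> unfolding inner_p by (auto simp: field_simps)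
      finally show ?thesis .
    qed
    then show ?thesis
      using ans None by simp
  next
    case (Some w)
    then have w: "w \<in> P" and gain: "c \<bullet> (p /\<^sub>R \<Delta> - w) > \<Phi> / \<Delta> / K"
      using LP' vertices_P by auto
    define q where "q = x - p + \<Delta> *\<^sub>R w"
    have qP: "q \<in> P"
    proof -
      \<comment> \<open>Index \<open>Suc M\<close> carries the new vertex \<open>w\<close> with the
        mass \<Delta> released by the others, so that \<open>q\<close> becomes a convex
        combination.\<close>
      define s where "s = (\<lambda>j. if j = Suc M then \<Delta> else l j - m j)"
      define a where "a = (\<lambda>j. if j = Suc M then w else u j)"
      have "(\<Sum>j=1..Suc M. s j *\<^sub>R a j) \<in> P"
      proof (rule convex_combination_mem[OF convex])
        have "(\<Sum>j=1..M. s j) = (\<Sum>j=1..M. l j - m j)"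
          by (intro sum.cong) (auto simp: s_def)
        then show "(\<Sum>j=1..Suc M. s j) = 1"
          using l1 m_sum by (simp add: s_def sum_subtractf)
      qed (use u_P w m \<Delta> in \<open>auto simp: s_def a_def le_Suc_eq\<close>)
      moreover have "(\<Sum>j=1..M. s j *\<^sub>R a j) = (\<Sum>j=1..M. (l j - m j) *\<^sub>R u j)"
        by (intro sum.cong) (auto simp: s_def a_def)
      then have "(\<Sum>j=1..Suc M. s j *\<^sub>R a j) = q"
        by (simp add: s_def a_def q_def x_u scaleR_left_diff_distrib sum_subtractf flip: mp)
      ultimately show ?thesis by simp
    qed
    have "c \<bullet> (x - q) = \<Delta> * (c \<bullet> (p /\<^sub>R \<Delta> - w))"
      unfolding inner_p[symmetric] by (simp add: q_def)
    also have "\<dots> > \<Delta> * (\<Phi> / \<Delta> / K)"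
      using gain \<Delta> by (intro mult_strict_left_mono)
    finally have "c \<bullet> (x - q) > \<Phi> / K"
      using \<Delta> by simp
    moreover have "norm (q - x) \<le> min (sqrt (real CARD('n)) * \<mu> * r) D"
    proof -
      have "norm (q - x) = norm (\<Delta> *\<^sub>R (w - p /\<^sub>R \<Delta>))"
        using \<Delta> by (simp add: q_def scaleR_diff_right)
      also have "\<dots> = \<Delta> * dist w (p /\<^sub>R \<Delta>)"
        using \<Delta> by (simp add: dist_norm)
      also have "\<dots> \<le> \<Delta> * D"
        using diameter_bounded_bound[OF compact_imp_bounded[OF compact] w pP] D \<Delta>
        by (intro mult_left_mono) auto
      also have "\<dots> = min (sqrt (real CARD('n)) * \<mu> * r) D"
        using D by (simp add: \<Delta>_def min_mult_distrib_right)
      finally show ?thesis .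
    qed
    ultimately show ?thesis
      using ans Some qP by (simp add: q_def)
  qed
qed

section \<open>First-order consequences of smoothness and strong convexity\<close>

text \<open>Along the segment from \<open>xmin\<close> to \<open>y\<close>, smoothness bounds the
  increase of \<open>f\<close> by a linear term in \<open>s\<close> plus a quadratic one. The
  increase is nonnegative, so dividing by a small \<open>s\<close> leaves the linear coefficient
  nonnegative up to any error.\<close>

lemma gradient_at_minimum_nonneg:
  assumes "smooth_function_on U f \<beta>" "P \<subseteq> U" "convex P"
    and "xmin \<in> P" "\<forall>y\<in>P. f xmin \<le> f y" "y \<in> P"
  shows "0 \<le> gradient f xmin \<bullet> (y - xmin)"
proof (rule field_le_epsilon)
  fix e :: real assume e: "e > 0"
  \<comment> \<open>The absolute value keeps \<open>B\<close> nonnegative whatever the sign of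
    \<beta>; the denominator \<open>B + 1\<close> is then positive and yields
    \<open>s * B \<le> e\<close>.\<close>
  define B where "B = \<bar>\<beta>\<bar> * (norm (y - xmin))\<^sup>2 / 2"
  define s where "s = min 1 (e / (B + 1))"
  have B: "0 \<le> B" by (simp add: B_def)
  then have s: "0 < s" "s \<le> 1" using e by (auto simp: s_def)
  define z where "z = xmin + s *\<^sub>R (y - xmin)"
  have "z = (1 - s) *\<^sub>R xmin + s *\<^sub>R y"
    by (simp add: z_def algebra_simps)
  then have zP: "z \<in> P"
    using assms s convexD[of P xmin y "1 - s" s] by simp
  have "0 \<le> f z - f xmin"
    using assms(5) zP by simp
  also have "\<dots> \<le> gradient f xmin \<bullet> (z - xmin) + \<beta> * (norm (z - xmin))\<^sup>2 / 2"
    using assms zP unfolding smooth_function_on_def by blast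
  also have "\<dots> = s * (gradient f xmin \<bullet> (y - xmin)) + s * s * (\<beta> * (norm (y - xmin))\<^sup>2 / 2)"
    by (simp add: z_def power2_eq_square)
  also have "\<dots> \<le> s * (gradient f xmin \<bullet> (y - xmin)) + s * s * B"
    unfolding B_def by (intro add_left_mono mult_left_mono divide_right_mono mult_right_mono) auto
  also have "\<dots> = s * (gradient f xmin \<bullet> (y - xmin) + s * B)"
    by (simp add: algebra_simps)
  finally have "0 \<le> gradient f xmin \<bullet> (y - xmin) + s * B"
    using s by (simp add: zero_le_mult_iff)
  moreover have "s * B \<le> e / (B + 1) * (B + 1)"
    using B e by (intro mult_mono) (auto simp: s_def)
  then have "s * B \<le> e"
    using B by simp
  ultimately show "0 \<le> gradient f xmin \<bullet> (y - xmin) + e"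
    by simp
qed

text \<open>An open nonempty set contains two distinct points, and there the lower and upper
  quadratic bounds share their linear term. The inequality serves to keep the step size \<alpha> at
  most 1.\<close>

lemma strong_convexity_le_smoothness:
  fixes U :: "'a::euclidean_space set"
  assumes "smooth_function_on U f \<beta>" "strongly_convex_on U f S" "open U" "U \<noteq> {}"
  shows "S \<le> \<beta>"
proof -
  obtain a where a: "a \<in> U" using assms by blast
  then obtain e where e: "e > 0" "cball a e \<subseteq> U"
    using assms(3) open_contains_cball by blast
  obtain b where b: "b \<in> U" "dist a b = e"
    using vector_choose_dist[of e a] e by (metis less_imp_le mem_cball order_refl subsetD)
  have "gradient f a \<bullet> (b - a) + S / 2 * (norm (b - a))\<^sup>2
      \<le> gradient f a \<bullet> (b - a) + \<beta> * (norm (b - a))\<^sup>2 / 2"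
    using assms(1,2) a b(1) unfolding smooth_function_on_def strongly_convex_on_def
    by (meson order_trans)
  then have "S * e\<^sup>2 \<le> \<beta> * e\<^sup>2"
    using b(2) by (simp add: dist_norm norm_minus_commute)
  then show ?thesis using e by simp
qed

section \<open>Convergence rate of the algorithm\<close>

theorem theorem3p6:
  fixes P U :: "(real ^ 'n) set" and f :: "real ^ 'n \<Rightarrow> real" and x :: "nat \<Rightarrow> real ^ 'n"
    and \<Phi> :: "nat \<Rightarrow> real" and xmin :: "real ^ 'n" and D \<mu> \<beta> S K \<alpha> :: real and T t :: nat
  assumes "polytope P"
    and "D > 0" and "diameter P \<le> D"
    and "\<mu> \<ge> 1" and "decomposition_property P D \<mu>"
    and "open U" and "P \<subseteq> U"
    and "convex_on U f" and "f differentiable_on U"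
    and "\<beta> > 0" and "smooth_function_on U f \<beta>"
    and "S > 0" and "strongly_convex_on U f S"
    and "xmin \<in> P" and "\<forall>y\<in>P. f xmin \<le> f y"
    and "K \<ge> 1"
    and "x 1 \<in> P"
    and "\<Phi> 0 \<ge> f (x 1) - f xmin" and "\<Phi> 0 > 0"
    and "\<alpha> = S / (2 * K * \<beta> * real CARD('n) * \<mu>\<^sup>2)"
    and "lazy_local_CG_run P D \<mu> f \<beta> S K \<alpha> T x \<Phi>"
    and "t \<le> T"
  shows "f (x (t + 1)) - f xmin \<le> \<Phi> t \<and>
    \<Phi> t \<le> \<Phi> 0 * ((1 + \<alpha> / (2 * K)) / (1 + \<alpha> / K)) ^ t"
proof -
  define n where "n = real CARD('n)"
  define \<rho> where "\<rho> = (1 + \<alpha> / (2 * K)) / (1 + \<alpha> / K)"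
  have n: "1 \<le> n"
    by (simp add: n_def Suc_le_eq)
  have \<alpha>: "\<alpha> = S / (2 * K * \<beta> * n * \<mu>\<^sup>2)"
    using assms(20) by (simp add: n_def)
  have \<alpha>0: "0 < \<alpha>"
    using assms n by (simp add: \<alpha>)
  have convex: "convex P"
    using assms(1) by (rule polytope_imp_convex)
  have "S \<le> \<beta>"
    using strong_convexity_le_smoothness[OF assms(11,13,6)] assms(7,14) by blast
  also have "\<beta> * 1 \<le> \<beta> * (2 * K * n * \<mu>\<^sup>2)"
    using assms(4,10,16) n
    by (intro mult_left_mono mult_ge1_I) auto
  finally have \<alpha>1: "\<alpha> \<le> 1"
    using assms n by (simp add: \<alpha> field_simps)
  \<comment> \<open>The induction also carries membership in \<open>P\<close> and positivity of
    \<Phi>, which the next oracle call and a positive radius require.\<close>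
  have "x (t + 1) \<in> P \<and> f (x (t + 1)) - f xmin \<le> \<Phi> t \<and> 0 < \<Phi> t \<and> \<Phi> t \<le> \<Phi> 0 * \<rho> ^ t"
    using assms(22)
  proof (induction t)
    case 0
    then show ?case using assms by simp
  next
    case (Suc t)
    define X where "X = x (Suc t)"
    define c where "c = gradient f X"
    have IH: "X \<in> P" "f X - f xmin \<le> \<Phi> t" "0 < \<Phi> t" "\<Phi> t \<le> \<Phi> 0 * \<rho> ^ t"
      using Suc by (simp_all add: X_def)
    obtain r p where r: "r = sqrt (2 * \<Phi> t / S)"
      and \<Phi>_Suc: "\<Phi> (Suc t) = (\<Phi> t + \<beta> / 2 * \<alpha>\<^sup>2 * min (n * \<mu>\<^sup>2 * r\<^sup>2) (D\<^sup>2)) / (1 + \<alpha> / K)"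
      and sep: "LLPsep P D \<mu> c X r (\<Phi> (Suc t)) K p"
      and step: "x (Suc t + 1) = (case p of None \<Rightarrow> X | Some q \<Rightarrow> X + \<alpha> *\<^sub>R (q - X))"
      using assms(21) Suc.prems unfolding lazy_local_CG_run_def n_def X_def c_def
      by (auto dest!: bspec[of _ _ "Suc t"])
    have r2: "r\<^sup>2 = 2 * \<Phi> t / S" and r0: "0 < r"
      using IH assms(12) by (simp_all add: r)
    define m where "m = min (n * \<mu>\<^sup>2 * r\<^sup>2) (D\<^sup>2)"
    have m0: "0 \<le> m"
      using n by (simp add: m_def)
    have K1: "0 < 1 + \<alpha> / K"
      using \<alpha>0 assms(16) by (simp add: add_pos_pos)
    have \<Phi>0: "0 < \<Phi> (Suc t)"
      unfolding \<Phi>_Suc m_def[symmetric] using IH m0 assms(10)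
      by (intro divide_pos_pos[OF _ K1] add_pos_nonneg mult_nonneg_nonneg) auto
    \<comment> \<open>The recursion as a fixed-point equation: its left side is the bound that a
      descent step starting from gap \<open>\<Phi> t\<close> will produce.\<close>
    have balance: "\<Phi> t - \<alpha> * (\<Phi> (Suc t) / K) + \<beta> / 2 * \<alpha>\<^sup>2 * m = \<Phi> (Suc t)"
    proof -
      have "\<Phi> (Suc t) * (1 + \<alpha> / K) = \<Phi> t + \<beta> / 2 * \<alpha>\<^sup>2 * m"
        unfolding \<Phi>_Suc m_def[symmetric] using K1 by simp
      then show ?thesis by (simp add: algebra_simps)
    qed
    have "\<Phi> (Suc t) \<le> \<Phi> t * \<rho>"
    proof -
      \<comment> \<open>The first argument of the minimum is used because \<open>r\<^sup>2\<close>
        makes it proportional to \<open>\<Phi> t\<close>. The choice of \<alpha> makes the quadratic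
        term at most \<open>\<Phi> t * \<alpha> / (2 * K)\<close>.\<close>
      have "\<beta> / 2 * \<alpha>\<^sup>2 * m \<le> \<beta> / 2 * \<alpha>\<^sup>2 * (n * \<mu>\<^sup>2 * r\<^sup>2)"
        using assms(10) by (intro mult_left_mono) (auto simp: m_def)
      also have "\<dots> = \<Phi> t * \<alpha> * (\<alpha> * (\<beta> * n * \<mu>\<^sup>2 / S))"
        unfolding r2 by (simp add: power2_eq_square)
      also have "\<alpha> * (\<beta> * n * \<mu>\<^sup>2 / S) = 1 / (2 * K)"
        using assms n by (simp add: \<alpha> field_simps)
      finally have "\<Phi> t + \<beta> / 2 * \<alpha>\<^sup>2 * m \<le> \<Phi> t * (1 + \<alpha> / (2 * K))"
        by (simp add: algebra_simps)
      then show ?thesis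
        unfolding \<Phi>_Suc m_def[symmetric] \<rho>_def using K1
        by (simp add: divide_right_mono)
    qed
    also have "\<dots> \<le> \<Phi> 0 * \<rho> ^ t * \<rho>"
      using IH \<alpha>0 assms(16) by (intro mult_right_mono) (auto simp: \<rho>_def)
    finally have rate: "\<Phi> (Suc t) \<le> \<Phi> 0 * \<rho> ^ Suc t"
      by (simp add: mult_ac)
    have sound: "case p of
      None \<Rightarrow> \<forall>y\<in>P. norm (X - y) \<le> r \<longrightarrow> c \<bullet> (X - y) \<le> \<Phi> (Suc t)
    | Some q \<Rightarrow> q \<in> P \<and> c \<bullet> (X - q) > \<Phi> (Suc t) / K \<and>
        norm (q - X) \<le> min (sqrt n * \<mu> * r) D"
      unfolding n_def
      using LLPsep_sound[OF assms(1-3) _ assms(5) r0 \<Phi>0 assms(16) sep] assms(4) by simp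
    have "x (Suc t + 1) \<in> P \<and> f (x (Suc t + 1)) - f xmin \<le> \<Phi> (Suc t)"
    proof (cases p)
      case None
      \<comment> \<open>Strong convexity is applied at \<open>xmin\<close>, where optimality makes
        the gradient term nonnegative. As \<open>S / 2 * r\<^sup>2 = \<Phi> t\<close>, this puts
        \<open>xmin\<close> within distance \<open>r\<close> of \<open>X\<close>.\<close>
      have "S / 2 * (norm (X - xmin))\<^sup>2 \<le> f X - f xmin"
      proof -
        have "gradient f xmin \<bullet> (X - xmin) + S / 2 * (norm (X - xmin))\<^sup>2 \<le> f X - f xmin"
          using assms(7,13,14) IH(1) unfolding strongly_convex_on_def by blast
        then show ?thesis
          using gradient_at_minimum_nonneg[OF assms(11,7) convex assms(14,15) IH(1)] by simp
      qed
      then have "(norm (X - xmin))\<^sup>2 \<le> r\<^sup>2"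
        using IH(2) assms(12) by (simp add: r2 field_simps)
      then have "norm (X - xmin) \<le> r"
        using r0 by (simp only: power2_le_iff_abs_le less_imp_le abs_norm_cancel)
      then have gap: "c \<bullet> (X - xmin) \<le> \<Phi> (Suc t)"
        using sound None assms(14) by simp
      \<comment> \<open>Strong convexity is now used at \<open>X\<close>, and only as the gradient
        inequality for convex functions: the certified linear gap bounds the primal gap, so the
        unmoved point meets the new bound.\<close>
      have "c \<bullet> (xmin - X) + S / 2 * (norm (xmin - X))\<^sup>2 \<le> f xmin - f X"
        using assms(7,13,14) IH(1) unfolding strongly_convex_on_def c_def by blast
      moreover have "0 \<le> S / 2 * (norm (xmin - X))\<^sup>2"
        using assms(12) by simp
      ultimately have "f X - f xmin \<le> c \<bullet> (X - xmin)"
        by (simp add: inner_diff_right)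
      then show ?thesis
        using gap step None IH(1) by simp
    next
      case (Some q)
      then have q: "q \<in> P" "c \<bullet> (X - q) > \<Phi> (Suc t) / K" "norm (q - X) \<le> sqrt n * \<mu> * r"
        "norm (q - X) \<le> D"
        using sound by auto
      define Y where "Y = X + \<alpha> *\<^sub>R (q - X)"
      have "Y = (1 - \<alpha>) *\<^sub>R X + \<alpha> *\<^sub>R q"
        by (simp add: Y_def algebra_simps)
      then have YP: "Y \<in> P"
        using convexD[OF convex IH(1) q(1), of "1 - \<alpha>" \<alpha>] \<alpha>0 \<alpha>1 by simp
      \<comment> \<open>Squaring the two distance bounds gives exactly the two arguments of the
        minimum in \<open>m\<close>.\<close>
      have "(norm (q - X))\<^sup>2 \<le> n * \<mu>\<^sup>2 * r\<^sup>2"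
        using power_mono[OF q(3), of 2] n by (simp add: power_mult_distrib)
      then have norm_m: "(norm (q - X))\<^sup>2 \<le> m"
        using power_mono[OF q(4), of 2] by (simp add: m_def)
      have "f Y - f X \<le> c \<bullet> (Y - X) + \<beta> * (norm (Y - X))\<^sup>2 / 2"
        using assms(7,11) IH(1) YP unfolding smooth_function_on_def c_def by blast
      also have "\<dots> = - (\<alpha> * (c \<bullet> (X - q))) + \<beta> / 2 * \<alpha>\<^sup>2 * (norm (q - X))\<^sup>2"
        by (simp add: Y_def inner_diff_right power_mult_distrib right_diff_distrib)
      also have "\<dots> \<le> - (\<alpha> * (\<Phi> (Suc t) / K)) + \<beta> / 2 * \<alpha>\<^sup>2 * m"
        using q(2) norm_m \<alpha>0 assms(10)
        by (intro add_mono le_imp_neg_le mult_left_mono) auto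
      finally have "f Y - f xmin \<le> \<Phi> (Suc t)"
        using IH(2) balance by linarith
      then show ?thesis
        using YP step Some by (simp add: Y_def)
    qed
    then show ?case
      using \<Phi>0 rate by simp
  qed
  then show ?thesis
    by (simp add: \<rho>_def)
qed

end
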